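(* Let $d\ge 1$, $\delta=(2+2d)^{-1/2}$, $\underline u=\frac12-\delta$, $\overline u=\frac12+\delta$ and $M=1$. Let $u\in C^3(\overline Q)$ be a solution of $$u_t=\operatorname{div}\left(u(1-u)\frac{Du}{1+|Du|^2}\right)\quad\text{in }Q,\qquad u(x,0)=u_0(x)\quad\text{for }x\in\mathbb{T}^d,$$ such that for all $t\ge 0$ $$\underline u\le u(\cdot,t)\le\overline u\quad\text{and}\quad\|Du(\cdot,t)\|_{L^\infty(\mathbb{T}^d)}\le M.$$ Then for all $t\ge 0$ $$\min_{\mathbb{T}^d}u_0\le u(\cdot,t)\le\max_{\mathbb{T}^d}u_0\quad\text{and}\quad\|Du(\cdot,t)\|_{L^\infty(\mathbb{T}^d)}\le\|Du_0\|_{L^\infty(\mathbb{T}^d)}.$$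
   Context: $\mathbb{T}^d=(\mathbb{R}/\mathbb{Z})^d$ is the $d$-dimensional torus, $Q:=\mathbb{T}^d\times(0,+\infty)$ and $\overline Q=\mathbb{T}^d\times[0,+\infty)$. $Du$ is the gradient of $u$ in the space variable $x$ and $\operatorname{div}$ is the divergence in $x$. $\|Du(\cdot,t)\|_{L^\infty(\mathbb{T}^d)}$ is the supremum over $x\in\mathbb{T}^d$ of the Euclidean norm $|Du(x,t)|$. *)

theory Defs
  imports "HOL-Analysis.Analysis"
begin

text \<open>Functions on the torus $(\mathbb{R}/\mathbb{Z})^d$ are represented by their lifts to
  \<open>real ^ 'n\<close> with \<open>CARD('n) = d\<close>, that is, by functions with period one in every coordinate.\<close>

definition torus_fun :: "(real ^ 'n \<Rightarrow> 'b) \<Rightarrow> bool" where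
  "torus_fun f \<longleftrightarrow> (\<forall>x i. f (x + axis i 1) = f x)"

text \<open>The set \<open>S\<close> need not be open: at boundary points the derivatives are taken relative to \<open>S\<close>.
  The definition is meant for sets such as closed half-spaces, where these relative derivatives
  are unique; all derivatives up to order \<open>k\<close> are then continuous up to the boundary.\<close>

primrec Ck_on :: "nat \<Rightarrow> 'a::euclidean_space set \<Rightarrow> ('a \<Rightarrow> real) \<Rightarrow> bool" where
  "Ck_on 0 S f \<longleftrightarrow> continuous_on S f"
| "Ck_on (Suc k) S f \<longleftrightarrow>
     (\<exists>f'. (\<forall>p\<in>S. (f has_derivative f' p) (at p within S)) \<and> (\<forall>v. Ck_on k S (\<lambda>p. f' p v)))"

definition grad :: "(real ^ 'n \<Rightarrow> real) \<Rightarrow> real ^ 'n \<Rightarrow> real ^ 'n" where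
  "grad f x = (\<chi> i. frechet_derivative f (at x) (axis i 1))"

definition divergence :: "(real ^ 'n \<Rightarrow> real ^ 'n) \<Rightarrow> real ^ 'n \<Rightarrow> real" where
  "divergence F x = (\<Sum>i\<in>UNIV. frechet_derivative F (at x) (axis i 1) $ i)"

text \<open>The supremum of the Euclidean norm. It is only meaningful for bounded \<open>F\<close>; continuous
  functions on the torus are bounded.\<close>

definition sup_norm :: "(real ^ 'n \<Rightarrow> real ^ 'n) \<Rightarrow> real" where
  "sup_norm F = (SUP x. norm (F x))"

text \<open>Minimum and maximum over the torus as attained values; they exist for continuous functions
  on the torus by compactness.\<close>

definition torus_min :: "(real ^ 'n \<Rightarrow> real) \<Rightarrow> real" where
  "torus_min f = (LEAST m. m \<in> range f)"

definition torus_max :: "(real ^ 'n \<Rightarrow> real) \<Rightarrow> real" where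
  "torus_max f = (GREATEST m. m \<in> range f)"

end

theory Submission
  imports Defs
begin

text \<open>Both bounds come from the parabolic maximum principle applied to \<open>\<plusminus>u\<close> and to \<open>|Du|\<^sup>2\<close>.
  At a spatial maximum of \<open>m = |Du|\<^sup>2\<close> the Hessian \<open>H\<close> of \<open>u\<close> annihilates \<open>Du\<close>, and differentiating
  the equation along \<open>Du\<close> gives, with \<open>f = u (1 - u)\<close> and \<open>W = D\<^sup>2 m / 2 \<le> 0\<close>,
  \[ \tfrac12 (1 + m)\, m_t = f \, \mathrm{tr}\Bigl(\bigl(I - \tfrac{2}{1 + m} Du \otimes Du\bigr) W\Bigr)
     - f |H|^2 + (1 - 2u)\, m \, \mathrm{tr} H - 2 m^2 . \]
  The first term is nonpositive because \<open>m \<le> 1\<close>. If \<open>Du\<close> does not vanish, then \<open>H\<close> has rank at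
  most \<open>d - 1\<close>, so \<open>(tr H)\<^sup>2 \<le> (d - 1) |H|\<^sup>2\<close>, and the remaining terms form a nonpositive quadratic
  form by the choice of \<open>\<delta>\<close>.\<close>

section \<open>Second derivatives\<close>

text \<open>\<open>\<phi>'\<close> is assumed differentiable at 0 only. If \<open>D\<close> were
  positive, \<open>\<phi>'\<close> would be positive just to the right of its zero, and the mean
  value theorem would lift \<open>\<phi>\<close> above its maximum.\<close>

lemma second_derivative_nonpos_at_max:
  fixes \<phi> :: "real \<Rightarrow> real"
  assumes d1: "\<And>s. (\<phi> has_real_derivative \<phi>' s) (at s)"
    and d2: "(\<phi>' has_real_derivative D) (at 0)"
    and max: "\<And>s. \<phi> s \<le> \<phi> 0"
  shows "\<phi>' 0 = 0" "D \<le> 0"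
proof -
  show z: "\<phi>' 0 = 0"
    by (rule DERIV_local_max[OF d1, of 1]) (use max in auto)
  show "D \<le> 0"
  proof (rule ccontr)
    assume "\<not> D \<le> 0"
    then obtain e where e: "e > 0" "\<And>h. 0 < h \<Longrightarrow> h < e \<Longrightarrow> \<phi>' 0 < \<phi>' (0 + h)"
      using DERIV_pos_inc_right[OF d2] by auto
    have "\<exists>z. 0 < z \<and> z < e/2 \<and> \<phi> (e/2) - \<phi> 0 = (e/2 - 0) * \<phi>' z"
      by (rule MVT2) (use e d1 in auto)
    then obtain x where "0 < x" "x < e/2" "\<phi> (e/2) - \<phi> 0 = (e/2) * \<phi>' x" by auto
    with e z have "\<phi> (e/2) > \<phi> 0"
      by (smt (verit) add_0 field_sum_of_halves zero_less_mult_iff)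
    with max show False by (simp add: leD)
  qed
qed

lemma has_derivative_line:
  fixes f :: "'a::real_normed_vector \<Rightarrow> real"
  assumes "(f has_derivative f') (at (x + s *\<^sub>R h))"
  shows "((\<lambda>s. f (x + s *\<^sub>R h)) has_real_derivative f' h) (at s)"
proof -
  have "((\<lambda>s. f (x + s *\<^sub>R h)) has_derivative (\<lambda>r. f' (r *\<^sub>R h))) (at s)"
    by (rule has_derivative_compose[where f = "\<lambda>s. x + s *\<^sub>R h" and g = f, OF _ assms])
      (auto intro!: derivative_eq_intros)
  moreover have "f' (r *\<^sub>R h) = f' h * r" for r
    using linear_scale[OF has_derivative_linear[OF assms], of r h] by simp
  ultimately show ?thesis
    by (simp add: has_field_derivative_def)
qed

text \<open>Two uses of the mean value theorem: in direction \<open>a\<close> for the increment of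
  \<open>f\<close> along \<open>b\<close>, then in direction \<open>b\<close> for the derivative
  along \<open>a\<close>. The second difference is symmetric in \<open>a\<close> and
  \<open>b\<close>, which makes mixed derivatives comparable.\<close>

lemma second_difference_mvt:
  fixes f :: "'a::real_normed_vector \<Rightarrow> real"
  assumes h: "h > 0"
    and S: "\<And>s r. 0 \<le> s \<Longrightarrow> s \<le> h \<Longrightarrow> 0 \<le> r \<Longrightarrow> r \<le> h \<Longrightarrow> z + s *\<^sub>R a + r *\<^sub>R b \<in> S"
    and f: "\<And>p. p \<in> S \<Longrightarrow> (f has_derivative f' p) (at p)"
    and fa: "\<And>p. p \<in> S \<Longrightarrow> ((\<lambda>p. f' p a) has_derivative fa' p) (at p)"
  obtains s r where "0 < s" "s < h" "0 < r" "r < h"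
    "f (z + h *\<^sub>R a + h *\<^sub>R b) - f (z + h *\<^sub>R a) - f (z + h *\<^sub>R b) + f z
       = h\<^sup>2 * fa' (z + s *\<^sub>R a + r *\<^sub>R b) b"
proof -
  define \<phi> where "\<phi> s = f (z + h *\<^sub>R b + s *\<^sub>R a) - f (z + s *\<^sub>R a)" for s
  have d\<phi>: "(\<phi> has_real_derivative f' (z + h *\<^sub>R b + s *\<^sub>R a) a - f' (z + s *\<^sub>R a) a) (at s)"
    if "0 \<le> s" "s \<le> h" for s
    unfolding \<phi>_def
    by (intro DERIV_diff has_derivative_line f)
      (use S[of s h] S[of s 0] that h in \<open>auto simp: algebra_simps\<close>)
  have "\<exists>s. 0 < s \<and> s < h \<and>
      \<phi> h - \<phi> 0 = (h - 0) * (f' (z + h *\<^sub>R b + s *\<^sub>R a) a - f' (z + s *\<^sub>R a) a)"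
    by (rule MVT2) (use h d\<phi> in auto)
  then obtain s where s: "0 < s" "s < h"
    "\<phi> h - \<phi> 0 = h * (f' (z + h *\<^sub>R b + s *\<^sub>R a) a - f' (z + s *\<^sub>R a) a)" by auto
  define \<psi> where "\<psi> r = f' (z + s *\<^sub>R a + r *\<^sub>R b) a" for r
  have d\<psi>: "(\<psi> has_real_derivative fa' (z + s *\<^sub>R a + r *\<^sub>R b) b) (at r)"
    if "0 \<le> r" "r \<le> h" for r
    unfolding \<psi>_def by (rule has_derivative_line[where f = "\<lambda>p. f' p a"], rule fa)
      (use S[of s r] that s in auto)
  have "\<exists>r. 0 < r \<and> r < h \<and> \<psi> h - \<psi> 0 = (h - 0) * fa' (z + s *\<^sub>R a + r *\<^sub>R b) b"
    by (rule MVT2) (use h d\<psi> in auto)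
  then obtain r where r: "0 < r" "r < h" "\<psi> h - \<psi> 0 = h * fa' (z + s *\<^sub>R a + r *\<^sub>R b) b" by auto
  have "\<phi> h - \<phi> 0 = h * (\<psi> h - \<psi> 0)"
    using s(3) by (simp add: \<psi>_def algebra_simps)
  then have "\<phi> h - \<phi> 0 = h\<^sup>2 * fa' (z + s *\<^sub>R a + r *\<^sub>R b) b"
    using r(3) by (simp add: power2_eq_square)
  moreover have "\<phi> h - \<phi> 0 = f (z + h *\<^sub>R a + h *\<^sub>R b) - f (z + h *\<^sub>R a) - f (z + h *\<^sub>R b) + f z"
    by (simp add: \<phi>_def algebra_simps)
  ultimately show ?thesis using that s(1,2) r(1,2) by metis
qed

text \<open>Both mixed derivatives, each at some point of a small parallelogram at \<open>z\<close>,
  equal the same second difference divided by \<open>h\<^sup>2\<close>. By continuity their values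
  at \<open>z\<close> cannot differ by \<open>2 * e\<close>.\<close>

lemma mixed_derivatives_commute:
  fixes f :: "'a::real_normed_vector \<Rightarrow> real"
  assumes "open S" "z \<in> S"
    and f: "\<And>p. p \<in> S \<Longrightarrow> (f has_derivative f' p) (at p)"
    and fa: "\<And>p. p \<in> S \<Longrightarrow> ((\<lambda>p. f' p a) has_derivative fa' p) (at p)"
    and fb: "\<And>p. p \<in> S \<Longrightarrow> ((\<lambda>p. f' p b) has_derivative fb' p) (at p)"
    and ca: "continuous_on S (\<lambda>p. fa' p b)"
    and cb: "continuous_on S (\<lambda>p. fb' p a)"
  shows "fa' z b = fb' z a"
proof (rule ccontr)
  assume ne: "fa' z b \<noteq> fb' z a"
  define e where "e = \<bar>fa' z b - fb' z a\<bar> / 2"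
  have e: "e > 0" using ne by (simp add: e_def)
  have "isCont (\<lambda>p. fa' p b) z" "isCont (\<lambda>p. fb' p a) z"
    using ca cb assms(1,2) continuous_on_eq_continuous_at by blast+
  then obtain d1 d2 where d1: "d1 > 0" "\<And>p. dist p z < d1 \<Longrightarrow> dist (fa' p b) (fa' z b) < e"
    and d2: "d2 > 0" "\<And>p. dist p z < d2 \<Longrightarrow> dist (fb' p a) (fb' z a) < e"
    using e unfolding continuous_at_eps_delta by metis
  obtain d3 where d3: "d3 > 0" "\<And>p. dist p z < d3 \<Longrightarrow> p \<in> S"
    using assms(1,2) by (auto simp: open_dist)
  define d where "d = min d1 (min d2 d3)"
  have d: "d > 0" using d1 d2 d3 by (simp add: d_def)
  \<comment> \<open>This size keeps the whole parallelogram within distance \<open>d\<close> of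
    \<open>z\<close>; the summand 1 covers \<open>a = b = 0\<close>.\<close>
  define h where "h = d / (1 + norm a + norm b)"
  have pos: "1 + norm a + norm b > 0" by (simp add: add_pos_nonneg)
  have h: "h > 0" using d pos by (simp add: h_def)
  have near: "dist (z + s *\<^sub>R a + r *\<^sub>R b) z < d" if "0 \<le> s" "s \<le> h" "0 \<le> r" "r \<le> h" for s r
  proof -
    have "dist (z + s *\<^sub>R a + r *\<^sub>R b) z = norm (s *\<^sub>R a + r *\<^sub>R b)" by (simp add: dist_norm)
    also have "\<dots> \<le> s * norm a + r * norm b"
      using norm_triangle_ineq[of "s *\<^sub>R a" "r *\<^sub>R b"] that by simp
    also have "\<dots> \<le> h * norm a + h * norm b"
      using that by (intro add_mono mult_right_mono) auto
    also have "\<dots> < h * (1 + norm a + norm b)" using h by (simp add: algebra_simps)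
    also have "\<dots> = d" using pos by (simp add: h_def)
    finally show ?thesis .
  qed
  have S: "z + s *\<^sub>R a + r *\<^sub>R b \<in> S" if "0 \<le> s" "s \<le> h" "0 \<le> r" "r \<le> h" for s r
    using near[OF that] d3(2) by (simp add: d_def)
  obtain s r where 1: "0 < s" "s < h" "0 < r" "r < h"
    "f (z + h *\<^sub>R a + h *\<^sub>R b) - f (z + h *\<^sub>R a) - f (z + h *\<^sub>R b) + f z
       = h\<^sup>2 * fa' (z + s *\<^sub>R a + r *\<^sub>R b) b"
    using second_difference_mvt[OF h S f fa] by blast
  have S': "z + s *\<^sub>R b + r *\<^sub>R a \<in> S" if "0 \<le> s" "s \<le> h" "0 \<le> r" "r \<le> h" for s r
    using S[of r s] that by (simp add: algebra_simps)
  obtain s' r' where 2: "0 < s'" "s' < h" "0 < r'" "r' < h"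
    "f (z + h *\<^sub>R b + h *\<^sub>R a) - f (z + h *\<^sub>R b) - f (z + h *\<^sub>R a) + f z
       = h\<^sup>2 * fb' (z + s' *\<^sub>R b + r' *\<^sub>R a) a"
    using second_difference_mvt[OF h S' f fb] by blast
  have "h\<^sup>2 * fa' (z + s *\<^sub>R a + r *\<^sub>R b) b = h\<^sup>2 * fb' (z + s' *\<^sub>R b + r' *\<^sub>R a) a"
    using 1(5) 2(5) by (simp add: algebra_simps)
  then have "fa' (z + s *\<^sub>R a + r *\<^sub>R b) b = fb' (z + r' *\<^sub>R a + s' *\<^sub>R b) a"
    using h by (simp add: algebra_simps)
  moreover have "dist (fa' (z + s *\<^sub>R a + r *\<^sub>R b) b) (fa' z b) < e"
    by (rule d1(2)) (use near[of s r] 1 d_def in auto)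
  moreover have "dist (fb' (z + r' *\<^sub>R a + s' *\<^sub>R b) a) (fb' z a) < e"
    by (rule d2(2)) (use near[of r' s'] 2 d_def in auto)
  ultimately show False unfolding e_def dist_real_def by (simp add: abs_if split: if_splits)
qed

section \<open>The maximum principle on the torus\<close>

text \<open>The coordinates of \<open>y\<close> are the fractional parts of those of
  \<open>x\<close>, so the two points differ by an integer vector. The choice of \<open>y\<close>
  precedes \<open>f\<close> and serves all periodic functions at once.\<close>

lemma torus_fun_representative:
  fixes x :: "real ^ 'n"
  obtains y where "y \<in> cbox 0 1" "\<And>f :: real ^ 'n \<Rightarrow> 'b. torus_fun f \<Longrightarrow> f x = f y"
proof -
  have shift: "f (x + n *\<^sub>R axis i 1) = f x"
    if f: "torus_fun f" and n: "n \<in> \<int>" for f :: "real ^ 'n \<Rightarrow> 'b" and x i and n :: real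
  proof -
    have nat: "f (x + real n *\<^sub>R axis i 1) = f x" for n x
    proof (induction n)
      case (Suc n)
      have "f (x + real (Suc n) *\<^sub>R axis i 1) = f ((x + real n *\<^sub>R axis i 1) + axis i 1)"
        by (simp add: algebra_simps)
      with Suc f show ?case by (simp add: torus_fun_def)
    qed simp
    obtain k where k: "n = of_int k" using n Ints_cases by blast
    show ?thesis
    proof (cases "k \<ge> 0")
      case True
      then show ?thesis using nat[of x "nat k"] k by simp
    next
      \<comment> \<open>Walking \<open>- k\<close> unit steps from the shifted point leads back to
        \<open>x\<close>, so natural multiples suffice.\<close>
      case False
      then show ?thesis using nat[of "x + n *\<^sub>R axis i 1" "nat (- k)"] k by simp
    qed
  qed
  have shifts: "f (x + (\<Sum>i\<in>I. n i *\<^sub>R axis i 1)) = f x"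
    if f: "torus_fun f" and n: "\<And>i. n i \<in> \<int>" and "finite I"
    for f :: "real ^ 'n \<Rightarrow> 'b" and x I and n :: "'n \<Rightarrow> real"
    using \<open>finite I\<close>
  proof (induction I)
    case (insert i I)
    then show ?case using shift[OF f n, of "x + (\<Sum>i\<in>I. n i *\<^sub>R axis i 1)" i i]
      by (simp add: add_ac)
  qed simp
  define y where "y = x + (\<Sum>i\<in>UNIV. (- of_int \<lfloor>x $ i\<rfloor>) *\<^sub>R axis i (1::real))"
  have yi: "y $ i = frac (x $ i)" for i
    by (simp add: y_def axis_def frac_def if_distrib cong: if_cong)
  have "y \<in> cbox 0 1"
    by (simp add: mem_box_cart yi less_imp_le[OF frac_lt_1])
  moreover have "f x = f y" if "torus_fun f" for f :: "real ^ 'n \<Rightarrow> 'b"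
    unfolding y_def using that by (intro shifts[symmetric]) auto
  ultimately show ?thesis using that by blast
qed

lemma torus_fun_bounded:
  fixes f :: "real ^ 'n \<Rightarrow> real"
  assumes "torus_fun f" "continuous_on UNIV f"
  obtains a b where "\<And>x. f a \<le> f x" "\<And>x. f x \<le> f b"
proof -
  have c: "compact (cbox (0::real^'n) 1)" "cbox (0::real^'n) 1 \<noteq> {}"
    by (auto simp: interval_ne_empty_cart)
  have ct: "continuous_on (cbox 0 1) f" using assms(2) continuous_on_subset by blast
  obtain a where a: "\<And>y. y \<in> cbox 0 1 \<Longrightarrow> f a \<le> f y"
    using continuous_attains_inf[OF c ct] by blast
  obtain b where b: "\<And>y. y \<in> cbox 0 1 \<Longrightarrow> f y \<le> f b"
    using continuous_attains_sup[OF c ct] by blast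
  have "f a \<le> f x \<and> f x \<le> f b" for x
    using torus_fun_representative[of x] a b assms(1) by metis
  then show ?thesis using that by blast
qed

text \<open>The sign of the time derivative is demanded only at spatial maxima, where the equation
  reveals it. Subtracting \<open>e * t\<close> makes that sign strict, so the maximum of the
  penalised function over a compact space-time cylinder must lie at time 0.\<close>

lemma torus_maximum_principle:
  fixes \<phi> :: "real ^ 'n \<Rightarrow> real \<Rightarrow> real"
  assumes torus: "\<And>t. t \<ge> 0 \<Longrightarrow> torus_fun (\<lambda>x. \<phi> x t)"
    and cont: "continuous_on (UNIV \<times> {0..}) (\<lambda>(x, t). \<phi> x t)"
    and decr: "\<And>x t. t > 0 \<Longrightarrow> (\<And>y. \<phi> y t \<le> \<phi> x t) \<Longrightarrow>
      \<exists>c\<le>0. ((\<lambda>s. \<phi> x s) has_real_derivative c) (at t)"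
    and init: "\<And>x. \<phi> x 0 \<le> C"
    and t: "t \<ge> 0"
  shows "\<phi> x t \<le> C"
proof (rule field_le_epsilon)
  fix e' :: real assume e': "e' > 0"
  define e where "e = e' / (t + 1)"
  have e: "e > 0" "e * t \<le> e'" using e' t by (auto simp: e_def field_simps)
  let ?K = "cbox (0::real^'n) 1 \<times> {0..t}"
  have "continuous_on ?K (\<lambda>p. \<phi> (fst p) (snd p) - e * snd p)"
    using continuous_on_subset[OF cont, of ?K] t
    by (intro continuous_intros) (force simp: case_prod_beta)
  moreover have "compact ?K" by (intro compact_Times) auto
  moreover have "?K \<noteq> {}" using t by (auto simp: interval_ne_empty_cart)
  ultimately obtain p where p: "p \<in> ?K"
    "\<And>q. q \<in> ?K \<Longrightarrow> \<phi> (fst q) (snd q) - e * snd q \<le> \<phi> (fst p) (snd p) - e * snd p"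
    using continuous_attains_sup[of ?K "\<lambda>p. \<phi> (fst p) (snd p) - e * snd p"] by blast
  obtain x0 t0 where p0: "p = (x0, t0)" by force
  have t0: "0 \<le> t0" "t0 \<le> t" using p p0 by auto
  have max: "\<phi> y s - e * s \<le> \<phi> x0 t0 - e * t0" if s: "0 \<le> s" "s \<le> t" for y s
  proof -
    obtain z where z: "z \<in> cbox 0 1" "\<And>f :: real ^ 'n \<Rightarrow> real. torus_fun f \<Longrightarrow> f y = f z"
      using torus_fun_representative[of y] by blast
    have "\<phi> z s - e * s \<le> \<phi> x0 t0 - e * t0"
      using p(2)[of "(z, s)"] z(1) s by (simp add: p0)
    then show ?thesis using z(2)[OF torus[OF s(1)]] by simp
  qed
  have "t0 = 0"
  proof (rule ccontr)
    assume "t0 \<noteq> 0"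
    with t0 have pos: "t0 > 0" by simp
    have "\<phi> y t0 \<le> \<phi> x0 t0" for y using max[of t0 y] t0 by simp
    then obtain c where c: "c \<le> 0" "((\<lambda>s. \<phi> x0 s) has_real_derivative c) (at t0)"
      using decr[OF pos] by blast
    have "((\<lambda>s. \<phi> x0 s - e * s) has_real_derivative c - e) (at t0)"
      using c(2) by (auto intro!: derivative_eq_intros)
    moreover have "c - e < 0" using c e by simp
    \<comment> \<open>Only earlier times are compared, so a maximum at the final time
      \<open>t0 = t\<close> is excluded as well.\<close>
    ultimately obtain d where d: "d > 0"
      "\<And>h. 0 < h \<Longrightarrow> h < d \<Longrightarrow> \<phi> x0 t0 - e * t0 < \<phi> x0 (t0 - h) - e * (t0 - h)"
      by (meson DERIV_neg_dec_left)
    define h where "h = min (d/2) t0"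
    have "0 < h" "h < d" "h \<le> t0" using d pos by (auto simp: h_def)
    then show False using d(2)[of h] max[of "t0 - h" x0] t0 by simp
  qed
  then have "\<phi> x t - e * t \<le> \<phi> x0 0" using max[of t x] t by simp
  then show "\<phi> x t \<le> C + e'" using init[of x0] e by linarith
qed

section \<open>Algebraic inequalities\<close>

text \<open>Cauchy-Schwarz for the Frobenius inner product of \<open>H\<close> and \<open>B\<close>.
  As \<open>H\<close> annihilates \<open>p\<close>, this product is \<open>m\<close> times the
  trace, while the squared norm of \<open>B\<close> is \<open>m\<^sup>2\<close> times the dimension
  minus one.\<close>

lemma trace_sq_le_of_kernel:
  fixes H :: "'n::finite \<Rightarrow> 'n \<Rightarrow> real" and p :: "'n \<Rightarrow> real"
  assumes ker: "\<And>j. (\<Sum>i\<in>UNIV. p i * H i j) = 0"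
    and p: "(\<Sum>i\<in>UNIV. (p i)\<^sup>2) \<noteq> 0"
  shows "(\<Sum>i\<in>UNIV. H i i)\<^sup>2 \<le> (real CARD('n) - 1) * (\<Sum>i\<in>UNIV. \<Sum>j\<in>UNIV. (H i j)\<^sup>2)"
proof -
  define m where "m = (\<Sum>i\<in>UNIV. (p i)\<^sup>2)"
  \<comment> \<open>\<open>B\<close> is \<open>m\<close> times the orthogonal projection to the complement of \<open>p\<close>.\<close>
  define B where "B i j = (if i = j then m else 0) - p i * p j" for i j :: 'n
  have HB: "(\<Sum>i\<in>UNIV. \<Sum>j\<in>UNIV. H i j * B i j) = m * (\<Sum>i\<in>UNIV. H i i)"
  proof -
    have "(\<Sum>i\<in>UNIV. \<Sum>j\<in>UNIV. H i j * (p i * p j)) = (\<Sum>j\<in>UNIV. p j * (\<Sum>i\<in>UNIV. p i * H i j))"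
      by (subst sum.swap) (simp add: sum_distrib_left mult_ac)
    then have "(\<Sum>i\<in>UNIV. \<Sum>j\<in>UNIV. H i j * (p i * p j)) = 0" by (simp add: ker)
    moreover have "(\<Sum>i\<in>UNIV. \<Sum>j\<in>UNIV. H i j * (if i = j then m else 0)) = m * (\<Sum>i\<in>UNIV. H i i)"
      by (simp add: if_distrib sum_distrib_left mult.commute cong: if_cong)
    ultimately show ?thesis
      by (simp add: B_def right_diff_distrib sum_subtractf)
  qed
  have BB: "(\<Sum>i\<in>UNIV. \<Sum>j\<in>UNIV. (B i j)\<^sup>2) = m\<^sup>2 * (real CARD('n) - 1)"
  proof -
    have "(B i j)\<^sup>2 = (if i = j then m\<^sup>2 - 2 * m * (p i)\<^sup>2 else 0) + (p i)\<^sup>2 * (p j)\<^sup>2" for i j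
      by (simp add: B_def power2_eq_square algebra_simps)
    then have "(\<Sum>i\<in>UNIV. \<Sum>j\<in>UNIV. (B i j)\<^sup>2)
        = (\<Sum>i\<in>UNIV. m\<^sup>2 - 2 * m * (p i)\<^sup>2) + (\<Sum>i\<in>UNIV. \<Sum>j\<in>UNIV. (p i)\<^sup>2 * (p j)\<^sup>2)"
      by (simp add: sum.distrib)
    also have "(\<Sum>i\<in>UNIV. \<Sum>j\<in>UNIV. (p i)\<^sup>2 * (p j)\<^sup>2) = m * m"
      by (simp add: m_def sum_product)
    also have "(\<Sum>i\<in>UNIV. m\<^sup>2 - 2 * m * (p i)\<^sup>2) = real CARD('n) * m\<^sup>2 - 2 * m * m"
      by (simp add: sum_subtractf m_def sum_distrib_left)
    finally show ?thesis by (simp add: power2_eq_square algebra_simps)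
  qed
  have "(\<Sum>(i,j)\<in>UNIV. H i j * B i j)\<^sup>2 \<le> (\<Sum>(i,j)\<in>UNIV. (H i j)\<^sup>2) * (\<Sum>(i,j)\<in>UNIV. (B i j)\<^sup>2)"
    using Cauchy_Schwarz_ineq_sum[of "\<lambda>(i,j). H i j" "\<lambda>(i,j). B i j" "UNIV :: ('n \<times> 'n) set"]
    by (simp add: case_prod_beta)
  then have "m\<^sup>2 * (\<Sum>i\<in>UNIV. H i i)\<^sup>2
      \<le> m\<^sup>2 * ((real CARD('n) - 1) * (\<Sum>i\<in>UNIV. \<Sum>j\<in>UNIV. (H i j)\<^sup>2))"
    by (simp add: UNIV_Times_UNIV[symmetric] sum.cartesian_product[symmetric] HB BB
        power_mult_distrib mult.left_commute del: UNIV_Times_UNIV) (simp add: mult_ac)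
  then show ?thesis using p by (simp add: m_def)
qed

text \<open>A nonpositive form has nonpositive trace on the orthogonal complement of
  \<open>p\<close>. Instead of choosing a basis there, the form is summed over the vectors
  \<open>h k\<close>, which are \<open>m\<close> times the projections of the unit vectors to the
  complement.\<close>

lemma trace_le_of_nonpos_form:
  fixes W :: "'n::finite \<Rightarrow> 'n \<Rightarrow> real" and p :: "'n \<Rightarrow> real"
  assumes W: "\<And>h. (\<Sum>i\<in>UNIV. \<Sum>j\<in>UNIV. h i * h j * W i j) \<le> 0"
  defines "m \<equiv> \<Sum>i\<in>UNIV. (p i)\<^sup>2"
  shows "m * (\<Sum>i\<in>UNIV. W i i) \<le> (\<Sum>i\<in>UNIV. \<Sum>j\<in>UNIV. p i * p j * W i j)"
proof (cases "m = 0")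
  case True
  then have "p i = 0" for i
    unfolding m_def by (simp add: sum_nonneg_eq_0_iff)
  with True show ?thesis by simp
next
  case False
  then have pos: "m > 0" unfolding m_def by (simp add: sum_nonneg less_le)
  define Wp where "Wp = (\<Sum>i\<in>UNIV. \<Sum>j\<in>UNIV. p i * p j * W i j)"
  define h where "h k i = (if i = k then m else 0) - p k * p i" for k i :: 'n
  have "(\<Sum>i\<in>UNIV. \<Sum>j\<in>UNIV. h k i * h k j * W i j)
      = m\<^sup>2 * W k k - m * (p k * (\<Sum>j\<in>UNIV. p j * W k j)) - m * (p k * (\<Sum>i\<in>UNIV. p i * W i k))
        + (p k)\<^sup>2 * Wp" for k
  proof -
    have "h k i * h k j * W i j = (if i = k then (if j = k then m\<^sup>2 * W k k else 0) else 0)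
        - (if i = k then m * (p k * (p j * W k j)) else 0)
        - (if j = k then m * (p k * (p i * W i k)) else 0) + (p k)\<^sup>2 * (p i * p j * W i j)" for i j
      by (simp add: h_def power2_eq_square algebra_simps)
    \<comment> \<open>Hoisting the condition out of the inner sum lets the Kronecker deltas collapse
      one after the other.\<close>
    moreover have "(\<Sum>j\<in>UNIV. if c then g j else 0) = (if c then \<Sum>j\<in>UNIV. g j else 0)"
      for c and g :: "'n \<Rightarrow> real"
      by simp
    ultimately show ?thesis
      by (simp add: sum.distrib sum_subtractf Wp_def sum_distrib_left)
  qed
  then have "(\<Sum>k\<in>UNIV. \<Sum>i\<in>UNIV. \<Sum>j\<in>UNIV. h k i * h k j * W i j)
      = m\<^sup>2 * (\<Sum>k\<in>UNIV. W k k) - m * (\<Sum>k\<in>UNIV. p k * (\<Sum>j\<in>UNIV. p j * W k j))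
        - m * (\<Sum>k\<in>UNIV. p k * (\<Sum>i\<in>UNIV. p i * W i k)) + m * Wp"
    by (simp add: sum.distrib sum_subtractf m_def sum_distrib_left sum_distrib_right)
  moreover have "(\<Sum>k\<in>UNIV. p k * (\<Sum>j\<in>UNIV. p j * W k j)) = Wp"
    by (simp add: Wp_def sum_distrib_left mult.assoc)
  moreover have "(\<Sum>k\<in>UNIV. p k * (\<Sum>i\<in>UNIV. p i * W i k)) = Wp"
    unfolding Wp_def by (subst sum.swap) (simp add: sum_distrib_left mult_ac)
  moreover have "(\<Sum>k\<in>UNIV. \<Sum>i\<in>UNIV. \<Sum>j\<in>UNIV. h k i * h k j * W i j) \<le> 0"
    by (intro sum_nonpos W)
  ultimately have "m * (m * (\<Sum>k\<in>UNIV. W k k)) \<le> m * Wp"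
    by (simp add: power2_eq_square algebra_simps)
  then show ?thesis using pos by (simp add: Wp_def)
qed

text \<open>For \<open>d \<ge> 1\<close> the allowed distance from 1/2 is at most 1/2, so
  \<open>v\<close> lies in the unit interval.\<close>

lemma mobility_nonneg:
  fixes v d :: real
  assumes d: "d \<ge> 1" and v: "(v - 1/2)\<^sup>2 \<le> 1 / (2 + 2 * d)"
  shows "0 \<le> v * (1 - v)"
proof -
  have "1 / (2 + 2 * d) \<le> 1 / 4" using d by (simp add: field_simps)
  moreover have "v * (1 - v) = 1/4 - (v - 1/2)\<^sup>2" by (simp add: power2_eq_square algebra_simps)
  ultimately show ?thesis using v by linarith
qed

text \<open>After eliminating \<open>N\<close> by the bound on \<open>S\<^sup>2\<close>, the hypothesis on \<open>v\<close> says that the quadratic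
  form in \<open>m\<close> and \<open>S\<close> has nonpositive discriminant.\<close>
lemma reaction_term_nonpos:
  fixes v m S N d :: real
  assumes d: "d \<ge> 1" and v: "(v - 1/2)\<^sup>2 \<le> 1 / (2 + 2 * d)"
    and S: "S\<^sup>2 \<le> (d - 1) * N" and m: "m \<ge> 0" and N: "N \<ge> 0"
  shows "(1 - 2 * v) * m * S - v * (1 - v) * N - 2 * m\<^sup>2 \<le> 0"
proof -
  have f: "v * (1 - v) = 1/4 - (v - 1/2)\<^sup>2" by (simp add: power2_eq_square algebra_simps)
  have vd: "(v - 1/2)\<^sup>2 * (2 + 2 * d) \<le> 1" using v d by (simp add: field_simps)
  \<comment> \<open>With \<open>q = (v - 1/2)\<^sup>2\<close> this reads
    \<open>4 * q * (d - 1) \<le> 2 - 8 * q\<close>, that is, \<open>(2 + 2 * d) * q \<le> 1\<close>.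
    This is what fixes the width of the admissible band around 1/2.\<close>
  have key: "(1 - 2 * v)\<^sup>2 * (d - 1) \<le> 8 * (v * (1 - v))"
    unfolding f using vd by (simp add: power2_eq_square algebra_simps)
  have f0: "v * (1 - v) \<ge> 0" using d v by (rule mobility_nonneg)
  have "((1 - 2 * v) * m * S)\<^sup>2 = (1 - 2 * v)\<^sup>2 * m\<^sup>2 * S\<^sup>2" by (simp add: power_mult_distrib)
  also have "\<dots> \<le> (1 - 2 * v)\<^sup>2 * m\<^sup>2 * ((d - 1) * N)" using S by (intro mult_left_mono) auto
  also have "\<dots> = ((1 - 2 * v)\<^sup>2 * (d - 1)) * (m\<^sup>2 * N)" by (simp add: mult_ac)
  also have "\<dots> \<le> (8 * (v * (1 - v))) * (m\<^sup>2 * N)" using key N by (intro mult_right_mono) auto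
  \<comment> \<open>The inequality \<open>4 * a * b \<le> (a + b)\<^sup>2\<close> for
    \<open>a = 2 * m\<^sup>2\<close> and \<open>b = v * (1 - v) * N\<close>.\<close>
  also have "\<dots> \<le> (2 * m\<^sup>2 + v * (1 - v) * N)\<^sup>2"
    using zero_le_power2[of "2 * m\<^sup>2 - v * (1 - v) * N"]
    by (simp add: power2_sum power2_diff algebra_simps)
  finally have "((1 - 2 * v) * m * S)\<^sup>2 \<le> (2 * m\<^sup>2 + v * (1 - v) * N)\<^sup>2" .
  then have "(1 - 2 * v) * m * S \<le> 2 * m\<^sup>2 + v * (1 - v) * N"
    by (rule power2_le_imp_le) (use f0 N in auto)
  then show ?thesis by linarith
qed

section \<open>The flux divergence\<close>

text \<open>The right-hand side of the equation after the product and chain rules, as a function of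
  the value, gradient and Hessian at one point. In this form it can be differentiated along a
  line.\<close>

definition expanded_flux_divergence :: "real \<Rightarrow> ('n::finite \<Rightarrow> real) \<Rightarrow> ('n \<Rightarrow> 'n \<Rightarrow> real) \<Rightarrow> real" where
  "expanded_flux_divergence v p H = (let m = (\<Sum>i\<in>UNIV. (p i)\<^sup>2) in
     (1 - 2 * v) * m / (1 + m)
     - 2 * (v * (1 - v)) * (\<Sum>i\<in>UNIV. \<Sum>j\<in>UNIV. p i * p j * H i j) / (1 + m)\<^sup>2
     + v * (1 - v) * (\<Sum>i\<in>UNIV. H i i) / (1 + m))"

text \<open>Models motion in the direction of the gradient at a maximum of its norm. The Hessian
  annihilates the gradient there, so \<open>p\<close> is stationary, \<open>v\<close> moves with
  speed \<open>m\<close>, and only \<open>v\<close> and \<open>H\<close> contribute.\<close>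

lemma has_real_derivative_expanded_flux_divergence:
  fixes v :: "real \<Rightarrow> real" and p :: "'n::finite \<Rightarrow> real \<Rightarrow> real"
  assumes v: "(v has_real_derivative m) (at s)"
    and p: "\<And>i. (p i has_real_derivative 0) (at s)"
    and H: "\<And>i j. (H i j has_real_derivative L i j) (at s)"
    and ker: "\<And>i. (\<Sum>j\<in>UNIV. p j s * H i j s) = 0"
    and m: "m = (\<Sum>i\<in>UNIV. (p i s)\<^sup>2)"
  shows "((\<lambda>s. expanded_flux_divergence (v s) (\<lambda>i. p i s) (\<lambda>i j. H i j s)) has_real_derivative
     - 2 * m\<^sup>2 / (1 + m)
     - 2 * (v s * (1 - v s)) * (\<Sum>i\<in>UNIV. \<Sum>j\<in>UNIV. p i s * p j s * L i j) / (1 + m)\<^sup>2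
     + v s * (1 - v s) * (\<Sum>i\<in>UNIV. L i i) / (1 + m)
     + (1 - 2 * v s) * m * (\<Sum>i\<in>UNIV. H i i s) / (1 + m)) (at s)"
proof -
  define G where "G s = (\<Sum>i\<in>UNIV. (p i s)\<^sup>2)" for s
  define E where "E s = (\<Sum>i\<in>UNIV. \<Sum>j\<in>UNIV. p i s * p j s * H i j s)" for s
  define S where "S s = (\<Sum>i\<in>UNIV. H i i s)" for s
  have dG: "(G has_real_derivative 0) (at s)"
    unfolding G_def by (auto intro!: derivative_eq_intros p)
  have dE: "(E has_real_derivative (\<Sum>i\<in>UNIV. \<Sum>j\<in>UNIV. p i s * p j s * L i j)) (at s)"
    unfolding E_def by (auto intro!: derivative_eq_intros p H sum.cong)
  have dS: "(S has_real_derivative (\<Sum>i\<in>UNIV. L i i)) (at s)"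
    unfolding S_def by (auto intro!: derivative_eq_intros H)
  have "E s = (\<Sum>i\<in>UNIV. p i s * (\<Sum>j\<in>UNIV. p j s * H i j s))"
    by (simp add: E_def sum_distrib_left mult.assoc)
  \<comment> \<open>This removes the term in which the mobility in front of \<open>E\<close> is
    differentiated.\<close>
  then have E0: "E s = 0" by (simp add: ker)
  have Gm: "G s = m" by (simp add: G_def m)
  have m0: "m \<ge> 0" unfolding m by (simp add: sum_nonneg)
  define r where "r s = inverse (1 + G s)" for s
  have dr: "(r has_real_derivative 0) (at s)"
    unfolding r_def using m0 by (auto intro!: derivative_eq_intros dG simp: Gm)
  have "((\<lambda>s. (1 - 2 * v s) * G s * r s - 2 * (v s * (1 - v s)) * E s * (r s)\<^sup>2
       + v s * (1 - v s) * S s * r s) has_real_derivative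
     - 2 * m\<^sup>2 * r s
     - 2 * (v s * (1 - v s)) * (\<Sum>i\<in>UNIV. \<Sum>j\<in>UNIV. p i s * p j s * L i j) * (r s)\<^sup>2
     + v s * (1 - v s) * (\<Sum>i\<in>UNIV. L i i) * r s
     + (1 - 2 * v s) * m * S s * r s) (at s)"
    by (rule derivative_eq_intros v dG dE dS dr refl | simp add: E0 Gm)+
      (simp add: power2_eq_square algebra_simps)
  then show ?thesis
    by (simp add: expanded_flux_divergence_def Let_def r_def Gm[symmetric]
        G_def E_def S_def divide_inverse power_inverse)
qed

section \<open>Partial derivatives on the closed half-space\<close>

text \<open>A horizontal slice lies inside the half-space even at \<open>t = 0\<close>, so the
  relative derivative restricts to a full derivative in space. A vertical line has points on both
  sides of \<open>t\<close> only for \<open>t > 0\<close>.\<close>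

lemma has_derivative_slices:
  fixes F :: "(real ^ 'n) \<times> real \<Rightarrow> real"
  assumes F: "(F has_derivative F') (at (x, t) within UNIV \<times> {0..})"
  shows "t \<ge> 0 \<Longrightarrow> ((\<lambda>y. F (y, t)) has_derivative (\<lambda>h. \<Sum>i\<in>UNIV. h $ i * F' (axis i 1, 0))) (at x)"
    and "t > 0 \<Longrightarrow> ((\<lambda>s. F (x, s)) has_real_derivative F' (0, 1)) (at t)"
proof -
  have lin: "linear F'" using F has_derivative_linear by blast
  show "((\<lambda>y. F (y, t)) has_derivative (\<lambda>h. \<Sum>i\<in>UNIV. h $ i * F' (axis i 1, 0))) (at x)"
    if t: "t \<ge> 0"
  proof -
    have "(F has_derivative F') (at (x, t) within (\<lambda>y. (y, t)) ` UNIV)"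
      by (rule has_derivative_subset[OF F]) (use t in auto)
    then have *: "((\<lambda>y. F (y, t)) has_derivative (\<lambda>h. F' (h, 0))) (at x)"
      by (rule has_derivative_in_compose[rotated])
        (intro has_derivative_Pair has_derivative_ident has_derivative_const)
    have "F' (h, 0) = (\<Sum>i\<in>UNIV. h $ i * F' (axis i 1, 0))" for h
    proof -
      have "(h, 0) = (\<Sum>i\<in>UNIV. h $ i *\<^sub>R (axis i (1::real), 0::real))"
        by (simp add: prod_eq_iff fst_sum snd_sum vec_eq_iff axis_def if_distrib cong: if_cong)
      moreover have "F' (h $ i *\<^sub>R axis i 1, 0) = h $ i * F' (axis i 1, 0)" for i
        using linear_scale[OF lin, of "h $ i" "(axis i 1, 0)"] by simp
      ultimately show ?thesis using lin by (simp add: linear_sum)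
    qed
    then show ?thesis by (intro has_derivative_eq_rhs[OF *] ext)
  qed
  show "((\<lambda>s. F (x, s)) has_real_derivative F' (0, 1)) (at t)" if t: "t > 0"
  proof -
    have "(F has_derivative F') (at (x, t) within (\<lambda>s. (x, s)) ` {0<..})"
      by (rule has_derivative_subset[OF F]) auto
    then have "((\<lambda>s. F (x, s)) has_derivative (\<lambda>r. F' (0, r))) (at t within {0<..})"
      by (rule has_derivative_in_compose[rotated])
        (intro has_derivative_Pair has_derivative_ident has_derivative_const)
    then have *: "((\<lambda>s. F (x, s)) has_derivative (\<lambda>r. F' (0, r))) (at t)"
      using t by (simp add: at_within_open[of t "{0<..}"])
    have "F' (0, r) = F' (0, 1) * r" for r
      using linear_scale[OF lin, of r "(0, 1)"] by simp
    then show ?thesis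
      unfolding has_field_derivative_def by (intro has_derivative_eq_rhs[OF *] ext)
  qed
qed

text \<open>\<open>P\<close>, \<open>H\<close>, \<open>K\<close> are the spatial derivatives of
  orders one to three, \<open>U\<close> is the time derivative and \<open>Q\<close> the mixed one.
  Continuity up to \<open>t = 0\<close> is kept for \<open>u\<close> and \<open>P\<close>, to which
  the maximum principle is applied; the higher derivatives are used at positive times.\<close>

lemma Ck_on_3_partial_derivatives:
  fixes u :: "real ^ 'n \<Rightarrow> real \<Rightarrow> real"
  assumes C3: "Ck_on 3 (UNIV \<times> {0..}) (\<lambda>(x, t). u x t)"
  obtains P :: "'n \<Rightarrow> real ^ 'n \<Rightarrow> real \<Rightarrow> real" and H :: "'n \<Rightarrow> 'n \<Rightarrow> real ^ 'n \<Rightarrow> real \<Rightarrow> real"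
    and K :: "'n \<Rightarrow> 'n \<Rightarrow> 'n \<Rightarrow> real ^ 'n \<Rightarrow> real \<Rightarrow> real" and U :: "real ^ 'n \<Rightarrow> real \<Rightarrow> real"
    and Q :: "'n \<Rightarrow> real ^ 'n \<Rightarrow> real \<Rightarrow> real"
  where "continuous_on (UNIV \<times> {0..}) (\<lambda>(x, t). u x t)"
    and "\<And>x t. t \<ge> 0 \<Longrightarrow> ((\<lambda>x. u x t) has_derivative (\<lambda>h. \<Sum>i\<in>UNIV. h $ i * P i x t)) (at x)"
    and "\<And>i. continuous_on (UNIV \<times> {0..}) (\<lambda>(x, t). P i x t)"
    and "\<And>i x t. t > 0 \<Longrightarrow> ((\<lambda>x. P i x t) has_derivative (\<lambda>h. \<Sum>j\<in>UNIV. h $ j * H i j x t)) (at x)"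
    and "\<And>i j x t. t > 0 \<Longrightarrow> ((\<lambda>x. H i j x t) has_derivative (\<lambda>h. \<Sum>k\<in>UNIV. h $ k * K i j k x t)) (at x)"
    and "\<And>i j x t. t > 0 \<Longrightarrow> H i j x t = H j i x t"
    and "\<And>i j k x t. t > 0 \<Longrightarrow> K i j k x t = K i k j x t"
    and "\<And>x t. t > 0 \<Longrightarrow> ((\<lambda>s. u x s) has_real_derivative U x t) (at t)"
    and "\<And>i x t. t > 0 \<Longrightarrow> ((\<lambda>s. P i x s) has_real_derivative Q i x t) (at t)"
    and "\<And>x t. t > 0 \<Longrightarrow> ((\<lambda>x. U x t) has_derivative (\<lambda>h. \<Sum>i\<in>UNIV. h $ i * Q i x t)) (at x)"
proof -
  let ?S = "UNIV \<times> {0..} :: ((real ^ 'n) \<times> real) set"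
  let ?I = "UNIV \<times> {0<..} :: ((real ^ 'n) \<times> real) set"
  define f where "f = (\<lambda>(x, t). u x t)"
  have "Ck_on (Suc (Suc (Suc 0))) ?S f"
    using C3 by (simp add: f_def numeral_3_eq_3)
  then obtain f1 where f1: "\<And>p. p \<in> ?S \<Longrightarrow> (f has_derivative f1 p) (at p within ?S)"
    and 1: "\<And>v. Ck_on (Suc (Suc 0)) ?S (\<lambda>p. f1 p v)"
    unfolding Ck_on.simps(2)[of "Suc (Suc 0)"] by blast
  \<comment> \<open>\<open>Ck_on\<close> provides a separate derivative for each fixed direction,
    hence the extra argument \<open>v\<close> of \<open>f2\<close> and the arguments
    \<open>v\<close>, \<open>w\<close> of \<open>f3\<close>.\<close>
  have "\<forall>v. \<exists>g. (\<forall>p\<in>?S. ((\<lambda>p. f1 p v) has_derivative g p) (at p within ?S)) \<and>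
      (\<forall>w. Ck_on (Suc 0) ?S (\<lambda>p. g p w))"
    using 1 by (simp only: Ck_on.simps) blast
  then obtain f2 where f2: "\<And>v p. p \<in> ?S \<Longrightarrow> ((\<lambda>p. f1 p v) has_derivative f2 v p) (at p within ?S)"
    and 2: "\<And>v w. Ck_on (Suc 0) ?S (\<lambda>p. f2 v p w)"
    by metis
  have "\<forall>v w. \<exists>g. (\<forall>p\<in>?S. ((\<lambda>p. f2 v p w) has_derivative g p) (at p within ?S)) \<and>
      (\<forall>z. continuous_on ?S (\<lambda>p. g p z))"
    using 2 by (simp only: Ck_on.simps) blast
  then obtain f3 where f3: "\<And>v w p. p \<in> ?S \<Longrightarrow>
      ((\<lambda>p. f2 v p w) has_derivative f3 v w p) (at p within ?S)"
    and 3: "\<And>v w z. continuous_on ?S (\<lambda>p. f3 v w p z)"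
    by metis
  have I: "open ?I" "?I \<subseteq> ?S" by (auto intro: open_Times)
  have at_I: "(g has_derivative g') (at p)"
    if "p \<in> ?I" "(g has_derivative g') (at p within ?S)" for g :: "_ \<Rightarrow> real" and g' p
    using that(2) unfolding at_within_interior[OF subsetD[OF interior_maximal[OF I(2,1)] that(1)]] .
  have m: "p \<in> ?S" if "p \<in> ?I" for p using that I(2) by blast
  have cf: "continuous_on ?S f" "continuous_on ?S (\<lambda>p. f1 p v)"
    "continuous_on ?S (\<lambda>p. f2 v p w)" for v w
    by (rule has_derivative_continuous_on, erule f1 f2 f3)+
  have sym2: "f2 v p w = f2 w p v" if p: "p \<in> ?I" for v w p
  proof (rule mixed_derivatives_commute[OF I(1) p, of f f1])
    show "(f has_derivative f1 q) (at q)" if "q \<in> ?I" for q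
      by (rule at_I[OF that f1[OF m[OF that]]])
    show "((\<lambda>p. f1 p v) has_derivative f2 v q) (at q)" if "q \<in> ?I" for q v
      by (rule at_I[OF that f2[OF m[OF that]]])
    then show "((\<lambda>p. f1 p w) has_derivative f2 w q) (at q)" if "q \<in> ?I" for q
      using that by blast
  qed (rule continuous_on_subset[OF cf(3) I(2)])+
  \<comment> \<open>Symmetry of second derivatives applied to the first derivative along
    \<open>v\<close>: it swaps the last two directions.\<close>
  have sym3: "f3 v w p z = f3 v z p w" if p: "p \<in> ?I" for v w z p
  proof (rule mixed_derivatives_commute[OF I(1) p, of "\<lambda>p. f1 p v" "f2 v"])
    show "((\<lambda>p. f1 p v) has_derivative f2 v q) (at q)" if "q \<in> ?I" for q
      by (rule at_I[OF that f2[OF m[OF that]]])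
    show "((\<lambda>p. f2 v p w) has_derivative f3 v w q) (at q)" if "q \<in> ?I" for q w
      by (rule at_I[OF that f3[OF m[OF that]]])
    then show "((\<lambda>p. f2 v p z) has_derivative f3 v z q) (at q)" if "q \<in> ?I" for q
      using that by blast
  qed (rule continuous_on_subset[OF 3 I(2)])+
  define e where "e i = (axis i 1 :: real ^ 'n, 0 :: real)" for i
  show ?thesis
  proof (rule that[where P = "\<lambda>i x t. f1 (x, t) (e i)" and Q = "\<lambda>i x t. f2 (e i) (x, t) (0, 1)"
        and H = "\<lambda>i j x t. f2 (e i) (x, t) (e j)" and K = "\<lambda>i j k x t. f3 (e i) (e j) (x, t) (e k)"
        and U = "\<lambda>x t. f1 (x, t) (0, 1)"])
    show "continuous_on ?S (\<lambda>(x, t). u x t)" using cf(1) by (simp add: f_def)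
    show "continuous_on ?S (\<lambda>(x, t). f1 (x, t) (e i))" for i using cf(2) by (simp add: case_prod_beta)
    fix x :: "real ^ 'n" and t :: real
    show "((\<lambda>x. u x t) has_derivative (\<lambda>h. \<Sum>i\<in>UNIV. h $ i * f1 (x, t) (e i))) (at x)" if "t \<ge> 0"
      using has_derivative_slices(1)[OF f1, of x t] that by (simp add: f_def e_def)
    assume t: "t > 0"
    then have m: "(x, t) \<in> ?S" "(x, t) \<in> ?I" by auto
    show "((\<lambda>x. f1 (x, t) (e i)) has_derivative (\<lambda>h. \<Sum>j\<in>UNIV. h $ j * f2 (e i) (x, t) (e j))) (at x)" for i
      using has_derivative_slices(1)[OF f2[OF m(1)]] t by (simp add: e_def)
    show "((\<lambda>x. f2 (e i) (x, t) (e j)) has_derivative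
        (\<lambda>h. \<Sum>k\<in>UNIV. h $ k * f3 (e i) (e j) (x, t) (e k))) (at x)" for i j
      using has_derivative_slices(1)[OF f3[OF m(1)]] t by (simp add: e_def)
    show "f2 (e i) (x, t) (e j) = f2 (e j) (x, t) (e i)" for i j by (rule sym2[OF m(2)])
    show "f3 (e i) (e j) (x, t) (e k) = f3 (e i) (e k) (x, t) (e j)" for i j k by (rule sym3[OF m(2)])
    show "((\<lambda>s. u x s) has_real_derivative f1 (x, t) (0, 1)) (at t)"
      using has_derivative_slices(2)[OF f1[OF m(1)] t] by (simp add: f_def)
    show "((\<lambda>s. f1 (x, s) (e i)) has_real_derivative f2 (e i) (x, t) (0, 1)) (at t)" for i
      using has_derivative_slices(2)[OF f2[OF m(1)] t] .
    \<comment> \<open>Commuting space and time derivatives identifies the gradient of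
      \<open>U\<close> with the time derivative of \<open>P\<close>.\<close>
    show "((\<lambda>x. f1 (x, t) (0, 1)) has_derivative (\<lambda>h. \<Sum>i\<in>UNIV. h $ i * f2 (e i) (x, t) (0, 1))) (at x)"
      using has_derivative_slices(1)[OF f2[OF m(1), of "(0, 1)"]] t
      unfolding e_def sym2[OF m(2), of "(axis _ 1, 0)" "(0, 1)"] by simp
  qed
qed

section \<open>Gradient and divergence in coordinates\<close>

lemma has_derivative_vec_lambda:
  fixes f :: "'n::finite \<Rightarrow> 'a::real_normed_vector \<Rightarrow> real"
  assumes "\<And>i. (f i has_derivative f' i) (at x)"
  shows "((\<lambda>x. \<chi> i. f i x) has_derivative (\<lambda>h. \<chi> i. f' i h)) (at x)"
  by (rule has_derivative_componentwise_within[THEN iffD2])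
    (auto simp: Basis_vec_def inner_axis assms)

lemma sum_axis_mult: "(\<Sum>i\<in>UNIV. axis k 1 $ i * g i) = g k" for g :: "'n::finite \<Rightarrow> real"
  by (simp add: axis_def if_distrib[of "\<lambda>c. c * _"] cong: if_cong)

lemma grad_eq_vec_lambda:
  assumes "(v has_derivative (\<lambda>h. \<Sum>i\<in>UNIV. h $ i * P i)) (at x)"
  shows "grad v x = (\<chi> i. P i)"
  by (simp add: grad_def frechet_derivative_at[OF assms, symmetric] sum_axis_mult)

lemma norm_vec_lambda_sq: "(norm (\<chi> i. P i))\<^sup>2 = (\<Sum>i\<in>UNIV. (P i)\<^sup>2)"
  for P :: "'n::finite \<Rightarrow> real"
  unfolding power2_norm_eq_inner by (simp add: inner_vec_def power2_eq_square)

text \<open>The flux is the scalar \<open>c\<close> times the gradient. The derivative of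
  \<open>c\<close> has one part from the mobility and one from the denominator; the divergence sums
  the diagonal entries of the resulting explicit derivative.\<close>

lemma divergence_flux:
  fixes v :: "real ^ 'n \<Rightarrow> real" and P :: "'n \<Rightarrow> real ^ 'n \<Rightarrow> real"
  assumes v: "\<And>x. (v has_derivative (\<lambda>h. \<Sum>i\<in>UNIV. h $ i * P i x)) (at x)"
    and P: "\<And>i x. (P i has_derivative (\<lambda>h. \<Sum>j\<in>UNIV. h $ j * H i j x)) (at x)"
  shows "divergence (\<lambda>y. (v y * (1 - v y) / (1 + (norm (grad v y))\<^sup>2)) *\<^sub>R grad v y) x
    = expanded_flux_divergence (v x) (\<lambda>i. P i x) (\<lambda>i j. H i j x)"
proof -
  define G where "G y = (\<Sum>i\<in>UNIV. (P i y)\<^sup>2)" for y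
  have grad: "grad v y = (\<chi> i. P i y)" for y by (rule grad_eq_vec_lambda[OF v])
  then have normG: "(norm (grad v y))\<^sup>2 = G y" for y by (simp add: G_def norm_vec_lambda_sq)
  have G0: "1 + G y > 0" for y by (simp add: G_def sum_nonneg add_pos_nonneg)
  define c where "c y = v y * (1 - v y) * inverse (1 + G y)" for y
  define r where "r = inverse (1 + G x)"
  define dv where "dv h = (\<Sum>i\<in>UNIV. h $ i * P i x)" for h
  define dG where "dG h = (\<Sum>i\<in>UNIV. 2 * P i x * (\<Sum>j\<in>UNIV. h $ j * H i j x))" for h
  have "(G has_derivative dG) (at x)"
    unfolding G_def dG_def by (auto intro!: derivative_eq_intros P sum.cong simp: mult_ac)
  then have "(c has_derivative (\<lambda>h. (1 - 2 * v x) * dv h * r - v x * (1 - v x) * dG h * r\<^sup>2)) (at x)"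
    unfolding c_def using v[of x] G0[of x] unfolding dv_def[symmetric]
    by (auto intro!: derivative_eq_intros simp: r_def power2_eq_square algebra_simps)
  then have "((\<lambda>y. \<chi> i. c y * P i y) has_derivative (\<lambda>h. \<chi> i.
      c x * (\<Sum>j\<in>UNIV. h $ j * H i j x)
      + ((1 - 2 * v x) * dv h * r - v x * (1 - v x) * dG h * r\<^sup>2) * P i x)) (at x)"
    by (intro has_derivative_vec_lambda has_derivative_mult P)
  then have "divergence (\<lambda>y. \<chi> i. c y * P i y) x = (\<Sum>i\<in>UNIV. c x * H i i x
      + ((1 - 2 * v x) * P i x * r - v x * (1 - v x) * (\<Sum>k\<in>UNIV. 2 * P k x * H k i x) * r\<^sup>2) * P i x)"
    unfolding divergence_def
    by (simp add: frechet_derivative_at[symmetric] dv_def dG_def sum_axis_mult)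
  also have "\<dots> = c x * (\<Sum>i\<in>UNIV. H i i x) + (1 - 2 * v x) * r * G x
      - v x * (1 - v x) * r\<^sup>2 * (\<Sum>i\<in>UNIV. P i x * (\<Sum>k\<in>UNIV. 2 * P k x * H k i x))"
    by (simp add: G_def sum.distrib sum_subtractf sum_distrib_left algebra_simps power2_eq_square)
  also have "(\<Sum>i\<in>UNIV. P i x * (\<Sum>k\<in>UNIV. 2 * P k x * H k i x))
      = 2 * (\<Sum>i\<in>UNIV. \<Sum>j\<in>UNIV. P i x * P j x * H i j x)"
    by (subst sum.swap) (simp add: sum_distrib_left mult_ac)
  also have "c x * (\<Sum>i\<in>UNIV. H i i x) + (1 - 2 * v x) * r * G x
      - v x * (1 - v x) * r\<^sup>2 * (2 * (\<Sum>i\<in>UNIV. \<Sum>j\<in>UNIV. P i x * P j x * H i j x))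
      = expanded_flux_divergence (v x) (\<lambda>i. P i x) (\<lambda>i j. H i j x)"
    by (simp add: expanded_flux_divergence_def Let_def c_def r_def G_def divide_inverse power_inverse)
  also have "(\<lambda>y. \<chi> i. c y * P i y) = (\<lambda>y. (v y * (1 - v y) / (1 + (norm (grad v y))\<^sup>2)) *\<^sub>R grad v y)"
    unfolding normG unfolding grad by (simp add: fun_eq_iff vec_eq_iff c_def divide_inverse)
  finally show ?thesis .
qed

section \<open>The flux divergence at spatial maxima\<close>

text \<open>A positive \<open>\<sigma>\<close> treats maxima and a negative one minima. The gradient
  vanishes there, so only the mobility times the trace of the Hessian survives, and each diagonal
  entry has the right sign.\<close>

lemma flux_divergence_at_extremum:
  fixes v :: "real ^ 'n \<Rightarrow> real" and P :: "'n \<Rightarrow> real ^ 'n \<Rightarrow> real"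
  assumes v: "\<And>x. (v has_derivative (\<lambda>h. \<Sum>i\<in>UNIV. h $ i * P i x)) (at x)"
    and P: "\<And>i x. (P i has_derivative (\<lambda>h. \<Sum>j\<in>UNIV. h $ j * H i j x)) (at x)"
    and ext: "\<And>y. \<sigma> * v y \<le> \<sigma> * v x"
    and \<sigma>: "\<sigma> \<noteq> 0"
    and vx: "0 \<le> v x * (1 - v x)"
  shows "\<sigma> * expanded_flux_divergence (v x) (\<lambda>i. P i x) (\<lambda>i j. H i j x) \<le> 0"
proof -
  have d1: "((\<lambda>s. \<sigma> * v (x + s *\<^sub>R axis k 1)) has_real_derivative \<sigma> * P k (x + s *\<^sub>R axis k 1)) (at s)" for s k
    using has_derivative_line[where x = x and s = s and h = "axis k 1", OF v] by (intro DERIV_cmult) (simp add: sum_axis_mult)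
  have d2: "((\<lambda>s. \<sigma> * P k (x + s *\<^sub>R axis k 1)) has_real_derivative \<sigma> * H k k x) (at 0)" for k
    using has_derivative_line[where x = x and s = 0 and h = "axis k 1", OF P, of k] by (intro DERIV_cmult) (simp add: sum_axis_mult)
  have P0: "P k x = 0" and Hk: "\<sigma> * H k k x \<le> 0" for k
    using second_derivative_nonpos_at_max[OF d1 d2] ext \<sigma> by auto
  have "\<sigma> * expanded_flux_divergence (v x) (\<lambda>i. P i x) (\<lambda>i j. H i j x)
      = v x * (1 - v x) * (\<Sum>i\<in>UNIV. \<sigma> * H i i x)"
    by (simp add: expanded_flux_divergence_def P0 sum_distrib_left mult_ac)
  also have "\<dots> \<le> 0" by (intro mult_nonneg_nonpos[OF vx] sum_nonpos Hk)
  finally show ?thesis .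
qed

text \<open>\<open>P\<close>, \<open>H\<close>, \<open>K\<close> are the first, second and third partial derivatives of \<open>v\<close>, and \<open>Q\<close> is the
  gradient of the flux divergence. In the proof, \<open>W\<close> is half the Hessian of \<open>|Dv|\<^sup>2\<close>.\<close>
lemma flux_divergence_gradient_max:
  fixes v :: "real ^ 'n \<Rightarrow> real" and P :: "'n \<Rightarrow> real ^ 'n \<Rightarrow> real"
  assumes v: "\<And>x. (v has_derivative (\<lambda>h. \<Sum>i\<in>UNIV. h $ i * P i x)) (at x)"
    and P: "\<And>i x. (P i has_derivative (\<lambda>h. \<Sum>j\<in>UNIV. h $ j * H i j x)) (at x)"
    and H: "\<And>i j x. (H i j has_derivative (\<lambda>h. \<Sum>k\<in>UNIV. h $ k * K i j k x)) (at x)"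
    and symH: "\<And>i j x. H i j x = H j i x"
    and symK: "\<And>i j k x. K i j k x = K i k j x"
    and R: "((\<lambda>y. expanded_flux_divergence (v y) (\<lambda>i. P i y) (\<lambda>i j. H i j y))
        has_derivative (\<lambda>h. \<Sum>i\<in>UNIV. h $ i * Q i)) (at x)"
    and max: "\<And>y. (\<Sum>i\<in>UNIV. (P i y)\<^sup>2) \<le> (\<Sum>i\<in>UNIV. (P i x)\<^sup>2)"
    and le1: "(\<Sum>i\<in>UNIV. (P i x)\<^sup>2) \<le> 1"
    and vx: "(v x - 1/2)\<^sup>2 \<le> 1 / (2 + 2 * real CARD('n))"
  shows "(\<Sum>i\<in>UNIV. P i x * Q i) \<le> 0"
proof -
  define m where "m = (\<Sum>i\<in>UNIV. (P i x)\<^sup>2)"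
  define S where "S = (\<Sum>i\<in>UNIV. H i i x)"
  define N where "N = (\<Sum>i\<in>UNIV. \<Sum>j\<in>UNIV. (H i j x)\<^sup>2)"
  define W where "W j k = (\<Sum>i\<in>UNIV. H i j x * H i k x + P i x * K i j k x)" for j k
  define f where "f = v x * (1 - v x)"
  have m: "0 \<le> m" "m \<le> 1" using le1 by (auto simp: m_def sum_nonneg)
  have N0: "N \<ge> 0" by (simp add: N_def sum_nonneg)
  have lineP: "((\<lambda>s. P i (x + s *\<^sub>R h)) has_real_derivative
      (\<Sum>j\<in>UNIV. h $ j * H i j (x + s *\<^sub>R h))) (at s)" for i s h
    by (rule has_derivative_line[OF P])
  have lineH: "((\<lambda>s. H i j (x + s *\<^sub>R h)) has_real_derivative
      (\<Sum>k\<in>UNIV. h $ k * K i j k (x + s *\<^sub>R h))) (at s)" for i j s h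
    by (rule has_derivative_line[OF H])
  \<comment> \<open>First and second order conditions for the squared gradient norm at its maximum
    \<open>x\<close>, along the line in direction \<open>h\<close>.\<close>
  have first: "(\<Sum>i\<in>UNIV. 2 * P i x * (\<Sum>j\<in>UNIV. h $ j * H i j x)) = 0"
    and second: "(\<Sum>i\<in>UNIV. 2 * ((\<Sum>j\<in>UNIV. h $ j * H i j x)\<^sup>2
      + P i x * (\<Sum>j\<in>UNIV. h $ j * (\<Sum>k\<in>UNIV. h $ k * K i j k x)))) \<le> 0" for h
  proof -
    have d1: "((\<lambda>s. \<Sum>i\<in>UNIV. (P i (x + s *\<^sub>R h))\<^sup>2) has_real_derivative
        (\<Sum>i\<in>UNIV. 2 * P i (x + s *\<^sub>R h) * (\<Sum>j\<in>UNIV. h $ j * H i j (x + s *\<^sub>R h)))) (at s)" for s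
      by (auto intro!: derivative_eq_intros lineP sum.cong)
    have lP: "((\<lambda>s. P i (x + s *\<^sub>R h)) has_real_derivative (\<Sum>j\<in>UNIV. h $ j * H i j x)) (at 0)" for i
      using lineP[of i h 0] by simp
    have lH: "((\<lambda>s. H i j (x + s *\<^sub>R h)) has_real_derivative (\<Sum>k\<in>UNIV. h $ k * K i j k x)) (at 0)" for i j
      using lineH[of i j h 0] by simp
    have d2: "((\<lambda>s. \<Sum>i\<in>UNIV. 2 * P i (x + s *\<^sub>R h) * (\<Sum>j\<in>UNIV. h $ j * H i j (x + s *\<^sub>R h)))
        has_real_derivative (\<Sum>i\<in>UNIV. 2 * ((\<Sum>j\<in>UNIV. h $ j * H i j x)\<^sup>2
          + P i x * (\<Sum>j\<in>UNIV. h $ j * (\<Sum>k\<in>UNIV. h $ k * K i j k x))))) (at 0)"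
      by (auto intro!: derivative_eq_intros lP lH sum.cong simp: power2_eq_square algebra_simps)
    from second_derivative_nonpos_at_max[OF d1 d2] max
    show "(\<Sum>i\<in>UNIV. 2 * P i x * (\<Sum>j\<in>UNIV. h $ j * H i j x)) = 0"
      "(\<Sum>i\<in>UNIV. 2 * ((\<Sum>j\<in>UNIV. h $ j * H i j x)\<^sup>2
      + P i x * (\<Sum>j\<in>UNIV. h $ j * (\<Sum>k\<in>UNIV. h $ k * K i j k x)))) \<le> 0"
      by simp_all
  qed
  have ker: "(\<Sum>i\<in>UNIV. P i x * H i k x) = 0" for k
    using first[of "axis k 1"]
    by (simp add: axis_def if_distrib[of "\<lambda>c. c * _"] mult.assoc sum_distrib_left[symmetric] cong: if_cong)
  have ker': "(\<Sum>j\<in>UNIV. P j x * H i j x) = 0" for i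
    using ker[of i] by (simp add: symH[of i])
  have W: "(\<Sum>j\<in>UNIV. \<Sum>k\<in>UNIV. h j * h k * W j k) =
      (\<Sum>i\<in>UNIV. (\<Sum>j\<in>UNIV. h j * H i j x)\<^sup>2 + P i x * (\<Sum>j\<in>UNIV. h j * (\<Sum>k\<in>UNIV. h k * K i j k x)))" for h
  proof -
    have "(\<Sum>j\<in>UNIV. \<Sum>k\<in>UNIV. h j * h k * W j k) =
        (\<Sum>j\<in>UNIV. \<Sum>i\<in>UNIV. \<Sum>k\<in>UNIV. h j * h k * (H i j x * H i k x + P i x * K i j k x))"
      unfolding W_def sum_distrib_left by (intro sum.cong refl sum.swap)
    also have "\<dots> = (\<Sum>i\<in>UNIV. \<Sum>j\<in>UNIV. \<Sum>k\<in>UNIV. h j * h k * (H i j x * H i k x + P i x * K i j k x))"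
      by (rule sum.swap)
    also have "\<dots> = (\<Sum>i\<in>UNIV. (\<Sum>j\<in>UNIV. h j * H i j x)\<^sup>2
        + P i x * (\<Sum>j\<in>UNIV. h j * (\<Sum>k\<in>UNIV. h k * K i j k x)))"
      by (simp add: power2_eq_square sum_product sum_distrib_left sum.distrib algebra_simps)
    finally show ?thesis .
  qed
  have W0: "(\<Sum>j\<in>UNIV. \<Sum>k\<in>UNIV. h j * h k * W j k) \<le> 0" for h
    unfolding W using second[of "\<chi> i. h i"] by (simp only: sum_distrib_left[symmetric]) simp
  define Wp where "Wp = (\<Sum>j\<in>UNIV. \<Sum>k\<in>UNIV. P j x * P k x * W j k)"
  have Wp0: "Wp \<le> 0" unfolding Wp_def by (rule W0)
  have trW: "m * (\<Sum>i\<in>UNIV. W i i) \<le> Wp"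
    unfolding m_def Wp_def by (rule trace_le_of_nonpos_form[OF W0])
  define L where "L i j = (\<Sum>k\<in>UNIV. P k x * K i j k x)" for i j
  \<comment> \<open>Obtained by differentiating the symmetry of \<open>H\<close>; together with
    \<open>symK\<close> it makes \<open>K\<close> symmetric in all indices.\<close>
  have symK': "K i j k x = K j i k x" for i j k
  proof -
    have "((\<lambda>y. H i j y) has_derivative (\<lambda>h. \<Sum>k\<in>UNIV. h $ k * K j i k x)) (at x)"
      using H[of j i x] by (simp add: symH[of i j])
    from has_derivative_unique[OF H this] have
      "(\<Sum>l\<in>UNIV. axis k 1 $ l * K i j l x) = (\<Sum>l\<in>UNIV. axis k 1 $ l * K j i l x)"
      by meson
    then show ?thesis by (simp add: axis_def if_distrib[of "\<lambda>c. c * _"] cong: if_cong)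
  qed
  \<comment> \<open>A Bochner identity: \<open>L\<close> is the derivative of the Hessian along the
    gradient, and its trace differs from that of \<open>W\<close> by the squared norm of the
    Hessian.\<close>
  have LW: "(\<Sum>i\<in>UNIV. L i i) = (\<Sum>i\<in>UNIV. W i i) - N"
  proof -
    have "(\<Sum>i\<in>UNIV. L i i) = (\<Sum>j\<in>UNIV. \<Sum>i\<in>UNIV. P i x * K i j j x)"
      unfolding L_def by (intro sum.cong refl) (metis symK symK')
    moreover have "N = (\<Sum>j\<in>UNIV. \<Sum>i\<in>UNIV. (H i j x)\<^sup>2)"
      unfolding N_def by (rule sum.swap)
    ultimately show ?thesis by (simp add: W_def sum.distrib power2_eq_square)
  qed
  \<comment> \<open>On the gradient itself the part of \<open>W\<close> quadratic in
    \<open>H\<close> vanishes by \<open>ker'\<close>.\<close>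
  have LWp: "(\<Sum>i\<in>UNIV. \<Sum>j\<in>UNIV. P i x * P j x * L i j) = Wp"
    unfolding Wp_def W by (simp add: ker' L_def sum_distrib_left mult_ac)
  define D where "D = - 2 * m\<^sup>2 / (1 + m) - 2 * f * Wp / (1 + m)\<^sup>2
      + f * (\<Sum>i\<in>UNIV. L i i) / (1 + m) + (1 - 2 * v x) * m * S / (1 + m)"
  define p where "p = (\<chi> i. P i x)"
  \<comment> \<open>Both sides are the derivative of the flux divergence along the gradient: one
    comes from \<open>R\<close>, the other from the explicit formula.\<close>
  have "(\<Sum>i\<in>UNIV. P i x * Q i) = D"
  proof (rule DERIV_unique)
    show "((\<lambda>s. expanded_flux_divergence (v (x + s *\<^sub>R p)) (\<lambda>i. P i (x + s *\<^sub>R p))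
        (\<lambda>i j. H i j (x + s *\<^sub>R p))) has_real_derivative (\<Sum>i\<in>UNIV. P i x * Q i)) (at 0)"
      using has_derivative_line[where x = x and s = 0 and h = p, simplified, OF R]
      by (simp add: p_def)
    have "((\<lambda>s. v (x + s *\<^sub>R p)) has_real_derivative m) (at 0)"
      using has_derivative_line[where x = x and s = 0 and h = p, OF v]
      by (simp add: p_def m_def power2_eq_square)
    moreover have "((\<lambda>s. P i (x + s *\<^sub>R p)) has_real_derivative 0) (at 0)" for i
      using lineP[of i p 0] by (simp add: p_def ker')
    moreover have "((\<lambda>s. H i j (x + s *\<^sub>R p)) has_real_derivative L i j) (at 0)" for i j
      using lineH[of i j p 0] by (simp add: p_def L_def)
    ultimately have "((\<lambda>s. expanded_flux_divergence (v (x + s *\<^sub>R p)) (\<lambda>i. P i (x + s *\<^sub>R p))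
        (\<lambda>i j. H i j (x + s *\<^sub>R p))) has_real_derivative
      - 2 * m\<^sup>2 / (1 + m)
      - 2 * (v (x + 0 *\<^sub>R p) * (1 - v (x + 0 *\<^sub>R p)))
        * (\<Sum>i\<in>UNIV. \<Sum>j\<in>UNIV. P i (x + 0 *\<^sub>R p) * P j (x + 0 *\<^sub>R p) * L i j) / (1 + m)\<^sup>2
      + v (x + 0 *\<^sub>R p) * (1 - v (x + 0 *\<^sub>R p)) * (\<Sum>i\<in>UNIV. L i i) / (1 + m)
      + (1 - 2 * v (x + 0 *\<^sub>R p)) * m * (\<Sum>i\<in>UNIV. H i i (x + 0 *\<^sub>R p)) / (1 + m)) (at 0)"
      by (rule has_real_derivative_expanded_flux_divergence) (simp_all add: ker' m_def)
    then show "((\<lambda>s. expanded_flux_divergence (v (x + s *\<^sub>R p)) (\<lambda>i. P i (x + s *\<^sub>R p))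
        (\<lambda>i j. H i j (x + s *\<^sub>R p))) has_real_derivative D) (at 0)"
      by (simp add: D_def LWp f_def S_def)
  qed
  moreover have "D \<le> 0"
  proof (cases "m = 0")
    case True
    then have P0: "P i x = 0" for i by (simp add: m_def sum_nonneg_eq_0_iff)
    then show ?thesis using True by (simp add: D_def L_def Wp_def)
  next
    case False
    with m have pos: "m > 0" by simp
    have f0: "f \<ge> 0"
      unfolding f_def using vx by (rule mobility_nonneg[rotated]) simp
    have "S\<^sup>2 \<le> (real CARD('n) - 1) * N"
      unfolding S_def N_def
      by (rule trace_sq_le_of_kernel[where p = "\<lambda>i. P i x"]) (use ker False in \<open>auto simp: m_def\<close>)
    then have react: "(1 - 2 * v x) * m * S - f * N - 2 * m\<^sup>2 \<le> 0"
      unfolding f_def using zero_less_card_finite[where 'a = 'n] vx m N0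
      by (intro reaction_term_nonpos) auto
    \<comment> \<open>The gradient bound enters here: \<open>m \<le> 1\<close> gives
      \<open>2 * m \<le> 1 + m\<close>, and dividing the nonpositive \<open>Wp\<close> by the
      smaller number makes it more negative.\<close>
    have "(\<Sum>i\<in>UNIV. W i i) - 2 * Wp / (1 + m) \<le> 0"
    proof -
      have "(\<Sum>i\<in>UNIV. W i i) \<le> Wp / m" using trW pos by (simp add: field_simps)
      also have "\<dots> \<le> 2 * Wp / (1 + m)"
        using mult_right_mono_neg[OF m(2) Wp0] pos by (simp add: field_simps)
      finally show ?thesis by simp
    qed
    then have "f * ((\<Sum>i\<in>UNIV. W i i) - 2 * Wp / (1 + m)) \<le> 0"
      using f0 by (rule mult_nonneg_nonpos[rotated])
    with react have "((1 - 2 * v x) * m * S - f * N - 2 * m\<^sup>2)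
        + f * ((\<Sum>i\<in>UNIV. W i i) - 2 * Wp / (1 + m)) \<le> 0" by linarith
    moreover have "D = (((1 - 2 * v x) * m * S - f * N - 2 * m\<^sup>2)
        + f * ((\<Sum>i\<in>UNIV. W i i) - 2 * Wp / (1 + m))) / (1 + m)"
      unfolding D_def LW using pos by (simp add: divide_simps power2_eq_square) (simp add: algebra_simps)
    ultimately show ?thesis using pos by (simp add: divide_nonpos_pos)
  qed
  ultimately show ?thesis by simp
qed

section \<open>The bounds\<close>

lemma torus_fun_grad:
  fixes v :: "real ^ 'n \<Rightarrow> real"
  assumes v: "torus_fun v" and diff: "\<And>x. v differentiable (at x)"
  shows "torus_fun (grad v)"
  unfolding torus_fun_def
proof (intro allI)
  fix x and i :: 'n
  define D where "D = frechet_derivative v (at (x + axis i 1))"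
  have D: "(v has_derivative D) (at (x + axis i 1))"
    using diff by (simp add: D_def frechet_derivative_works)
  have "((\<lambda>y. v (y + axis i 1)) has_derivative D) (at x)"
    by (rule has_derivative_compose[where f = "\<lambda>y. y + axis i 1" and g = v, OF _ D])
      (auto intro!: derivative_eq_intros)
  then have "(v has_derivative D) (at x)"
    using v by (simp add: torus_fun_def)
  then have "frechet_derivative v (at x) = D"
    using frechet_derivative_at by metis
  then show "grad v (x + axis i 1) = grad v x"
    by (simp add: grad_def D_def)
qed

text \<open>Compactness of the torus bounds the range, so that the supremum of reals really is an
  upper bound.\<close>

lemma norm_le_sup_norm:
  assumes "torus_fun F" "continuous_on UNIV F"
  shows "norm (F x) \<le> sup_norm F"
proof -
  have "torus_fun (\<lambda>x. norm (F x))" using assms(1) by (simp add: torus_fun_def)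
  moreover have "continuous_on UNIV (\<lambda>x. norm (F x))" using assms(2) by (intro continuous_intros)
  ultimately obtain b where "\<And>x. norm (F x) \<le> norm (F b)"
    using torus_fun_bounded by blast
  then have "bdd_above (range (\<lambda>x. norm (F x)))" by (intro bdd_aboveI2)
  then show ?thesis unfolding sup_norm_def by (rule cSUP_upper[rotated]) simp
qed

text \<open>Compactness provides points where the extreme values are attained, which gives
  \<open>LEAST\<close> and \<open>GREATEST\<close> their intended meaning.\<close>

lemma torus_min_le_torus_max_ge:
  assumes "torus_fun f" "continuous_on UNIV f"
  shows "torus_min f \<le> f x" "f x \<le> torus_max f"
proof -
  obtain a b where a: "\<And>x. f a \<le> f x" and b: "\<And>x. f x \<le> f b"
    using torus_fun_bounded[OF assms] by blast
  have "torus_min f = f a"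
    unfolding torus_min_def by (rule Least_equality) (use a in auto)
  then show "torus_min f \<le> f x" using a by simp
  have "torus_max f = f b"
    unfolding torus_max_def by (rule Greatest_equality) (use b in auto)
  then show "f x \<le> torus_max f" using b by simp
qed

theorem corollary3p4:
  fixes u :: "real ^ 'n \<Rightarrow> real \<Rightarrow> real" and u0 :: "real ^ 'n \<Rightarrow> real"
    and \<delta> ulo uhi M :: real
  assumes delta: "\<delta> = (2 + 2 * real CARD('n)) powr (- 1 / 2)"
    and ulo: "ulo = 1 / 2 - \<delta>"
    and uhi: "uhi = 1 / 2 + \<delta>"
    and M: "M = 1"
    and torus: "\<And>t. t \<ge> 0 \<Longrightarrow> torus_fun (\<lambda>x. u x t)"
    and C3: "Ck_on 3 (UNIV \<times> {0..}) (\<lambda>(x, t). u x t)"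
    and pde: "\<And>x t. t > 0 \<Longrightarrow>
      ((\<lambda>s. u x s) has_real_derivative
        divergence (\<lambda>y. (u y t * (1 - u y t) / (1 + (norm (grad (\<lambda>z. u z t) y))\<^sup>2))
                        *\<^sub>R grad (\<lambda>z. u z t) y) x) (at t)"
    and init: "\<And>x. u x 0 = u0 x"
    and bounds: "\<And>x t. t \<ge> 0 \<Longrightarrow> ulo \<le> u x t \<and> u x t \<le> uhi"
    and grad_bound: "\<And>t. t \<ge> 0 \<Longrightarrow> sup_norm (grad (\<lambda>x. u x t)) \<le> M"
  shows "\<forall>t\<ge>0. (\<forall>x. torus_min u0 \<le> u x t \<and> u x t \<le> torus_max u0) \<and>
           sup_norm (grad (\<lambda>x. u x t)) \<le> sup_norm (grad u0)"
proof -
  obtain P :: "'n \<Rightarrow> real ^ 'n \<Rightarrow> real \<Rightarrow> real" and H :: "'n \<Rightarrow> 'n \<Rightarrow> real ^ 'n \<Rightarrow> real \<Rightarrow> real"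
    and K :: "'n \<Rightarrow> 'n \<Rightarrow> 'n \<Rightarrow> real ^ 'n \<Rightarrow> real \<Rightarrow> real" and U :: "real ^ 'n \<Rightarrow> real \<Rightarrow> real"
    and Q :: "'n \<Rightarrow> real ^ 'n \<Rightarrow> real \<Rightarrow> real"
    where cu: "continuous_on (UNIV \<times> {0..}) (\<lambda>(x, t). u x t)"
    and du: "\<And>x t. t \<ge> 0 \<Longrightarrow> ((\<lambda>x. u x t) has_derivative (\<lambda>h. \<Sum>i\<in>UNIV. h $ i * P i x t)) (at x)"
    and cP: "\<And>i. continuous_on (UNIV \<times> {0..}) (\<lambda>(x, t). P i x t)"
    and dP: "\<And>i x t. t > 0 \<Longrightarrow> ((\<lambda>x. P i x t) has_derivative (\<lambda>h. \<Sum>j\<in>UNIV. h $ j * H i j x t)) (at x)"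
    and dH: "\<And>i j x t. t > 0 \<Longrightarrow> ((\<lambda>x. H i j x t) has_derivative (\<lambda>h. \<Sum>k\<in>UNIV. h $ k * K i j k x t)) (at x)"
    and symH: "\<And>i j x t. t > 0 \<Longrightarrow> H i j x t = H j i x t"
    and symK: "\<And>i j k x t. t > 0 \<Longrightarrow> K i j k x t = K i k j x t"
    and ut: "\<And>x t. t > 0 \<Longrightarrow> ((\<lambda>s. u x s) has_real_derivative U x t) (at t)"
    and Pt: "\<And>i x t. t > 0 \<Longrightarrow> ((\<lambda>s. P i x s) has_real_derivative Q i x t) (at t)"
    and dU: "\<And>x t. t > 0 \<Longrightarrow> ((\<lambda>x. U x t) has_derivative (\<lambda>h. \<Sum>i\<in>UNIV. h $ i * Q i x t)) (at x)"
    by (rule Ck_on_3_partial_derivatives[OF C3]) (rule that)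
  \<comment> \<open>Uniqueness of the time derivative turns the equation into an identity for
    \<open>U\<close>, so \<open>Q\<close> is the spatial gradient of the flux divergence.\<close>
  have U: "U x t = expanded_flux_divergence (u x t) (\<lambda>i. P i x t) (\<lambda>i j. H i j x t)" if t: "t > 0" for x t
    using DERIV_unique[OF ut[OF t] pde[OF t]]
      divergence_flux[OF du[OF less_imp_le[OF t]] dP[OF t]] by simp
  have centred: "(u x t - 1/2)\<^sup>2 \<le> 1 / (2 + 2 * real CARD('n))" if t: "t \<ge> 0" for x t
  proof -
    have "\<delta>\<^sup>2 = (2 + 2 * real CARD('n)) powr (- 1)"
      unfolding delta power2_eq_square powr_add[symmetric] by simp
    also have "\<dots> = 1 / (2 + 2 * real CARD('n))"
      by (simp add: powr_minus_divide)
    finally have "\<delta>\<^sup>2 = 1 / (2 + 2 * real CARD('n))" .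
    moreover have "\<bar>u x t - 1/2\<bar> \<le> \<bar>\<delta>\<bar>" using bounds[OF t, of x] ulo uhi by linarith
    ultimately show ?thesis by (simp add: abs_le_square_iff)
  qed
  have mobility: "0 \<le> u x t * (1 - u x t)" if "t \<ge> 0" for x t
    using centred[OF that] by (rule mobility_nonneg[rotated]) simp
  have slice: "continuous_on UNIV (\<lambda>x. g x t)"
    if "continuous_on (UNIV \<times> {0..}) (\<lambda>(x, t). g x t)" "t \<ge> 0" for g :: "real ^ 'n \<Rightarrow> real \<Rightarrow> real" and t
  proof -
    have "continuous_on UNIV (\<lambda>x :: real ^ 'n. (x, t))" by (intro continuous_intros)
    then show ?thesis
      using continuous_on_compose2[OF that(1), of UNIV "\<lambda>x. (x, t)"] that(2) by auto
  qed
  have u0: "u0 = (\<lambda>x. u x 0)" using init by auto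
  have u0_bounds: "torus_min u0 \<le> u x 0" "u x 0 \<le> torus_max u0" for x
    using torus_min_le_torus_max_ge[OF torus[OF order_refl] slice[OF cu order_refl]]
    by (simp_all add: u0)
  \<comment> \<open>Used with \<open>\<sigma> = 1\<close> for the upper bound and with
    \<open>\<sigma> = -1\<close> for the lower one.\<close>
  have principle: "\<sigma> * u x t \<le> C"
    if \<sigma>: "\<sigma> \<noteq> 0" and C: "\<And>x. \<sigma> * u x 0 \<le> C" and t: "t \<ge> 0" for \<sigma> C x t
  proof (rule torus_maximum_principle[where \<phi> = "\<lambda>x t. \<sigma> * u x t", OF _ _ _ C t])
    show "torus_fun (\<lambda>x. \<sigma> * u x t)" if "t \<ge> 0" for t
      using torus[OF that] by (simp add: torus_fun_def)
    show "continuous_on (UNIV \<times> {0..}) (\<lambda>(x, t). \<sigma> * u x t)"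
      using continuous_on_mult_left[OF cu, of \<sigma>] by (simp add: case_prod_beta)
  next
    fix x t assume t: "(0::real) < t" and max: "\<And>y. \<sigma> * u y t \<le> \<sigma> * u x t"
    have "\<sigma> * U x t \<le> 0"
      unfolding U[OF t] using t
      by (intro flux_divergence_at_extremum[where v = "\<lambda>x. u x t" and P = "\<lambda>i x. P i x t"
            and H = "\<lambda>i j x. H i j x t"] du dP max \<sigma> mobility) auto
    then show "\<exists>c\<le>0. ((\<lambda>s. \<sigma> * u x s) has_real_derivative c) (at t)"
      using DERIV_cmult[OF ut[OF t]] by blast
  qed
  have grad: "grad (\<lambda>x. u x t) = (\<lambda>x. \<chi> i. P i x t)" if "t \<ge> 0" for t
    using grad_eq_vec_lambda[OF du[OF that]] by blast
  have torus_grad: "torus_fun (grad (\<lambda>x. u x t))" if "t \<ge> 0" for t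
    using torus_fun_grad[OF torus[OF that]] du[OF that] by (auto simp: differentiable_def)
  have grad_le: "norm (grad (\<lambda>x. u x t) x) \<le> sup_norm (grad (\<lambda>x. u x t))" if t: "t \<ge> 0" for x t
    by (rule norm_le_sup_norm[OF torus_grad[OF t]])
      (auto simp: grad[OF t] intro!: continuous_on_vec_lambda slice cP t)
  \<comment> \<open>The squared norm is differentiable also where the gradient vanishes.\<close>
  define w where "w x t = (\<Sum>i\<in>UNIV. (P i x t)\<^sup>2)" for x t
  have w: "w x t = (norm (grad (\<lambda>x. u x t) x))\<^sup>2" if "t \<ge> 0" for x t
    by (simp add: grad[OF that] w_def norm_vec_lambda_sq)
  have w_le: "w x t \<le> (sup_norm (grad u0))\<^sup>2" if t: "t \<ge> 0" for x t
  proof (rule torus_maximum_principle[where \<phi> = w, OF _ _ _ _ t])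
    show "torus_fun (\<lambda>x. w x t)" if "t \<ge> 0" for t
      using torus_grad[OF that] by (simp add: w[OF that] torus_fun_def)
    show "continuous_on (UNIV \<times> {0..}) (\<lambda>(x, t). w x t)"
      unfolding w_def case_prod_beta using cP
      by (intro continuous_on_sum continuous_on_power) (simp add: case_prod_beta)
    show "w x 0 \<le> (sup_norm (grad u0))\<^sup>2" for x
      using power_mono[OF grad_le[of 0 x]] by (simp add: w u0)
  next
    fix x t assume t: "(0::real) < t" and max: "\<And>y. w y t \<le> w x t"
    have "norm (grad (\<lambda>x. u x t) x) \<le> 1"
      using grad_le[of t x] grad_bound[of t] t M by simp
    then have "w x t \<le> 1" using t by (simp add: w power_le_one)
    moreover have "((\<lambda>x. expanded_flux_divergence (u x t) (\<lambda>i. P i x t) (\<lambda>i j. H i j x t))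
        has_derivative (\<lambda>h. \<Sum>i\<in>UNIV. h $ i * Q i x t)) (at x)"
      using dU[OF t] by (simp add: U[OF t])
    ultimately have "(\<Sum>i\<in>UNIV. P i x t * Q i x t) \<le> 0"
      using t max unfolding w_def
      by (intro flux_divergence_gradient_max[where v = "\<lambda>x. u x t" and P = "\<lambda>i x. P i x t"
            and H = "\<lambda>i j x. H i j x t" and K = "\<lambda>i j k x. K i j k x t"]
          du dP dH symH symK centred) auto
    moreover have "((\<lambda>s. w x s) has_real_derivative 2 * (\<Sum>i\<in>UNIV. P i x t * Q i x t)) (at t)"
      unfolding w_def by (auto intro!: derivative_eq_intros Pt t sum.cong simp: sum_distrib_left)
    ultimately show "\<exists>c\<le>0. ((\<lambda>s. w x s) has_real_derivative c) (at t)"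
      by (intro exI[of _ "2 * (\<Sum>i\<in>UNIV. P i x t * Q i x t)"]) simp
  qed
  \<comment> \<open>Nonnegativity permits passing from the bound on squares to the bound on
    norms.\<close>
  have sup0: "0 \<le> sup_norm (grad u0)"
    using order_trans[OF norm_ge_zero grad_le[of 0]] by (simp add: u0)
  show ?thesis
  proof (intro allI impI conjI)
    fix t x assume t: "(0::real) \<le> t"
    show "torus_min u0 \<le> u x t" using principle[of "-1" "- torus_min u0", OF _ _ t] u0_bounds by simp
    show "u x t \<le> torus_max u0" using principle[of 1 "torus_max u0", OF _ _ t] u0_bounds by simp
  next
    fix t assume t: "(0::real) \<le> t"
    have "norm (grad (\<lambda>x. u x t) x) \<le> sup_norm (grad u0)" for x
      using w_le[OF t, of x] sup0 unfolding w[OF t] by (rule power2_le_imp_le)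
    then show "sup_norm (grad (\<lambda>x. u x t)) \<le> sup_norm (grad u0)"
      unfolding sup_norm_def[of "grad (\<lambda>x. u x t)"] by (intro cSUP_least) auto
  qed
qed

end
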